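(* Let $m\geq n \geq 2$ and $r\ge 1$ be integers and let $\gamma$ be a full $n$-Frenet curve in the unit Euclidean sphere $\mathbb{S}^m$. If $n \geq 2r$, then $\gamma$ is not $r$-harmonic.
   Context: $\mathbb{S}^m$ is the unit sphere (constant curvature $1$), oriented, with Levi-Civita connection $\nabla$ and curvature $R(X,Y)Z=\langle Y,Z\rangle X-\langle X,Z\rangle Y$. Curves $\gamma:I\to \mathbb{S}^m$ ($I\subset\mathbb{R}$ an interval) are smooth and parametrized by arc length $s$, with unit tangent $T=\gamma'$. Put $\nabla^0_TT=T$, $\nabla_T^kT=\nabla_T(\nabla_T^{k-1}T)$. The curve $\gamma$ is $r$-harmonic if \[ \tau_r(\gamma)=\nabla^{2r-1}_T T+ \sum_{\ell=0}^{r-2}(-1)^\ell R\left (\nabla^{2r-3-\ell}_T T ,\nabla^{\ell}_T T\right )T=0 \] (the sum is empty for $r=1$). For $2\le n\le m$, $\gamma$ is an $n$-Frenet curve if it admits an orthonormal field $\{F_1,\dots,F_n\}$ along $\gamma$ with $F_1=T$, $\nabla_TF_1=k_1F_2$, $\nabla_TF_i=-k_{i-1}F_{i-1}+k_iF_{i+1}$ for $2\le i\le n-1$, $\nabla_TF_n=-k_{n-1}F_{n-1}$, where $k_1(s),\dots,k_{n-1}(s)$ are positive smooth functions; in the special case $n=m$ the frame is instead chosen positively oriented and $k_{n-1}(s)$ is allowed to take any real value. It is full if $k_{n-1}(s)$ does not vanish at any point. *)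

theory Defs
  imports "HOL-Analysis.Analysis"
begin

text \<open>
  The sphere of dimension \<open>m\<close> is \<open>sphere 0 1\<close> in \<open>real ^ 'd\<close> with \<open>CARD('d) = m + 1\<close>. Curves and
  fields along them are total functions on \<open>real\<close> of which only the values on the interval \<open>I\<close>
  matter. Derivatives are taken within \<open>I\<close>, hence are one-sided at an endpoint belonging to \<open>I\<close>.
\<close>

definition deriv_on :: "real set \<Rightarrow> (real \<Rightarrow> 'a) \<Rightarrow> real \<Rightarrow> 'a::real_normed_vector" where
  "deriv_on I f = (\<lambda>s. vector_derivative f (at s within I))"

definition smooth_on_interval :: "real set \<Rightarrow> (real \<Rightarrow> 'a::real_normed_vector) \<Rightarrow> bool" where
  "smooth_on_interval I f \<longleftrightarrow>
     (\<forall>k. \<forall>s\<in>I. ((deriv_on I ^^ k) f) differentiable (at s within I))"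

definition unit_speed_sphere_curve :: "real set \<Rightarrow> (real \<Rightarrow> real ^ 'd) \<Rightarrow> bool" where
  "unit_speed_sphere_curve I \<gamma> \<longleftrightarrow>
     is_interval I \<and> interior I \<noteq> {} \<and>
     smooth_on_interval I \<gamma> \<and>
     (\<forall>s\<in>I. \<gamma> s \<in> sphere 0 1) \<and>
     (\<forall>s\<in>I. norm (deriv_on I \<gamma> s) = 1)"

definition tangent_field_along ::
    "real set \<Rightarrow> (real \<Rightarrow> real ^ 'd) \<Rightarrow> (real \<Rightarrow> real ^ 'd) \<Rightarrow> bool" where
  "tangent_field_along I \<gamma> V \<longleftrightarrow> smooth_on_interval I V \<and> (\<forall>s\<in>I. V s \<bullet> \<gamma> s = 0)"

text \<open>
  The Levi-Civita connection of the sphere along \<open>\<gamma>\<close>: the orthogonal projection of the Euclidean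
  derivative to the tangent space at \<open>\<gamma> s\<close>, which is the orthogonal complement of \<open>\<gamma> s\<close>.
\<close>

definition cov_deriv ::
    "real set \<Rightarrow> (real \<Rightarrow> real ^ 'd) \<Rightarrow> (real \<Rightarrow> real ^ 'd) \<Rightarrow> real \<Rightarrow> real ^ 'd" where
  "cov_deriv I \<gamma> V = (\<lambda>s. deriv_on I V s - (deriv_on I V s \<bullet> \<gamma> s) *\<^sub>R \<gamma> s)"

definition cov_deriv_T :: "real set \<Rightarrow> (real \<Rightarrow> real ^ 'd) \<Rightarrow> nat \<Rightarrow> real \<Rightarrow> real ^ 'd" where
  "cov_deriv_T I \<gamma> k = (cov_deriv I \<gamma> ^^ k) (deriv_on I \<gamma>)"

definition sphere_curvature :: "real ^ 'd \<Rightarrow> real ^ 'd \<Rightarrow> real ^ 'd \<Rightarrow> real ^ 'd" where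
  "sphere_curvature X Y Z = (Y \<bullet> Z) *\<^sub>R X - (X \<bullet> Z) *\<^sub>R Y"

text \<open>
  The sum runs over \<open>0 \<le> l \<le> r - 2\<close>, written \<open>l < r - 1\<close> so that it is empty for \<open>r = 1\<close>. For
  \<open>r \<ge> 1\<close> none of the subtractions on \<open>nat\<close> that are used is truncated.
\<close>

definition tension_field :: "nat \<Rightarrow> real set \<Rightarrow> (real \<Rightarrow> real ^ 'd) \<Rightarrow> real \<Rightarrow> real ^ 'd" where
  "tension_field r I \<gamma> s =
     cov_deriv_T I \<gamma> (2 * r - 1) s +
     (\<Sum>l<r - 1. (- 1) ^ l *\<^sub>R
        sphere_curvature (cov_deriv_T I \<gamma> (2 * r - 3 - l) s) (cov_deriv_T I \<gamma> l s)
          (deriv_on I \<gamma> s))"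

definition r_harmonic :: "nat \<Rightarrow> real set \<Rightarrow> (real \<Rightarrow> real ^ 'd) \<Rightarrow> bool" where
  "r_harmonic r I \<gamma> \<longleftrightarrow> (\<forall>s\<in>I. tension_field r I \<gamma> s = 0)"

text \<open>
  An orientation of the sphere is given by a numbering \<open>num\<close> of the coordinates by \<open>0, ..., m\<close>: it
  orients \<open>real ^ 'd\<close> by declaring the standard basis in that order to be positive, and the sphere
  by putting the outward normal first. Both orientations arise in this way. In the matrix below,
  column \<open>j\<close> is the vector number \<open>num j\<close> of the list \<open>p, F 1, ..., F m\<close>.
\<close>

definition orientation_numbering :: "nat \<Rightarrow> ('d::finite \<Rightarrow> nat) \<Rightarrow> bool" where
  "orientation_numbering m num \<longleftrightarrow> bij_betw num UNIV {0..m}"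

definition positively_oriented ::
    "('d::finite \<Rightarrow> nat) \<Rightarrow> real ^ 'd \<Rightarrow> (nat \<Rightarrow> real ^ 'd) \<Rightarrow> bool" where
  "positively_oriented num p F \<longleftrightarrow>
     det (\<chi> i j. (if num j = 0 then p else F (num j)) $ i) > 0"

text \<open>
  Only \<open>F 1, ..., F n\<close> and \<open>k 1, ..., k (n - 1)\<close> are used. Positivity of \<open>k (n - 1)\<close> is dropped
  exactly when \<open>n = m\<close>.
\<close>

definition frenet_frame ::
    "nat \<Rightarrow> ('d::finite \<Rightarrow> nat) \<Rightarrow> nat \<Rightarrow> real set \<Rightarrow> (real \<Rightarrow> real ^ 'd) \<Rightarrow>
      (nat \<Rightarrow> real \<Rightarrow> real ^ 'd) \<Rightarrow> (nat \<Rightarrow> real \<Rightarrow> real) \<Rightarrow> bool" where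
  "frenet_frame m num n I \<gamma> F k \<longleftrightarrow>
     (\<forall>i\<in>{1..n}. tangent_field_along I \<gamma> (F i)) \<and>
     (\<forall>s\<in>I. \<forall>i\<in>{1..n}. \<forall>j\<in>{1..n}. F i s \<bullet> F j s = (if i = j then 1 else 0)) \<and>
     (\<forall>i\<in>{1..n-1}. smooth_on_interval I (k i)) \<and>
     (\<forall>i\<in>{1..n-1}. \<not> (n = m \<and> i = n - 1) \<longrightarrow> (\<forall>s\<in>I. k i s > 0)) \<and>
     (n = m \<longrightarrow> (\<forall>s\<in>I. positively_oriented num (\<gamma> s) (\<lambda>i. F i s))) \<and>
     (\<forall>s\<in>I. F 1 s = deriv_on I \<gamma> s) \<and>
     (\<forall>s\<in>I. cov_deriv I \<gamma> (F 1) s = k 1 s *\<^sub>R F 2 s) \<and>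
     (\<forall>i\<in>{2..n-1}. \<forall>s\<in>I.
        cov_deriv I \<gamma> (F i) s = - k (i - 1) s *\<^sub>R F (i - 1) s + k i s *\<^sub>R F (i + 1) s) \<and>
     (\<forall>s\<in>I. cov_deriv I \<gamma> (F n) s = - k (n - 1) s *\<^sub>R F (n - 1) s)"

text \<open>
  On \<open>I\<close> the vectors \<open>F 1, ..., F n\<close> and the functions \<open>k 1, ..., k (n - 1)\<close> are determined by
  the curve (and, for \<open>n = m\<close>, the orientation), so fullness does not depend on the frame.
\<close>

definition full_frenet_curve ::
    "nat \<Rightarrow> ('d::finite \<Rightarrow> nat) \<Rightarrow> nat \<Rightarrow> real set \<Rightarrow> (real \<Rightarrow> real ^ 'd) \<Rightarrow> bool" where
  "full_frenet_curve m num n I \<gamma> \<longleftrightarrow>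
     unit_speed_sphere_curve I \<gamma> \<and>
     (\<exists>F k. frenet_frame m num n I \<gamma> F k \<and> (\<forall>s\<in>I. k (n - 1) s \<noteq> 0))"

end

theory Submission
  imports Defs
begin

text \<open>
  Differentiating \<open>\<langle>V, F i\<rangle>\<close> along the curve and inserting the Frenet equations for
  \<open>\<nabla> (F i)\<close> shows by induction that \<open>\<nabla>\<^sup>j T\<close> is orthogonal to \<open>F i\<close> for \<open>i > j + 1\<close>, while
  its component along \<open>F (j + 1)\<close> is \<open>k 1 \<cdots> k j\<close>. Hence the component of the \<open>r\<close>-tension field
  along \<open>F (2 r)\<close> comes from \<open>\<nabla>\<^bsup>2 r - 1\<^esup> T\<close> alone, as the curvature terms only involve
  derivatives of \<open>T\<close> of order at most \<open>2 r - 3\<close>; it equals \<open>k 1 \<cdots> k (2 r - 1)\<close>, which does not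
  vanish.
\<close>

section \<open>Derivatives relative to a subset of the line\<close>

lemma has_vector_derivative_deriv_on:
  "f differentiable (at s within I) \<Longrightarrow>
    (f has_vector_derivative deriv_on I f s) (at s within I)"
  by (simp add: deriv_on_def vector_derivative_works)

lemma deriv_on_eqI:
  assumes "(f has_vector_derivative D) (at s within I)" "at s within I \<noteq> bot"
  shows "deriv_on I f s = D"
  using assms unfolding deriv_on_def by (simp add: vector_derivative_within)

lemma has_vector_derivative_cong_on:
  assumes "\<And>t. t \<in> I \<Longrightarrow> f t = g t" "s \<in> I"
  shows "(f has_vector_derivative D) (at s within I) \<longleftrightarrow>
    (g has_vector_derivative D) (at s within I)"
  using assms by (metis has_vector_derivative_transform)

lemma deriv_on_cong:
  assumes "\<And>t. t \<in> I \<Longrightarrow> f t = g t" "s \<in> I"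
  shows "deriv_on I f s = deriv_on I g s"
  unfolding deriv_on_def vector_derivative_def
  using has_vector_derivative_cong_on[OF assms] by simp

lemma differentiable_cong_on:
  assumes "\<And>t. t \<in> I \<Longrightarrow> f t = g t" "s \<in> I"
  shows "f differentiable (at s within I) \<longleftrightarrow> g differentiable (at s within I)"
  using assms unfolding differentiable_def by (metis has_derivative_transform)

section \<open>Functions of class C^n on \<open>I\<close> and their closure properties\<close>

definition C_on :: "nat \<Rightarrow> real set \<Rightarrow> (real \<Rightarrow> 'a::real_normed_vector) \<Rightarrow> bool" where
  "C_on n I f \<longleftrightarrow> (\<forall>j\<le>n. \<forall>s\<in>I. ((deriv_on I ^^ j) f) differentiable (at s within I))"

text \<open>Reduces smoothness to finite orders, so that closure under sums and products can be
  shown by induction on the order.\<close>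

lemma smooth_iff_C_on: "smooth_on_interval I f \<longleftrightarrow> (\<forall>n. C_on n I f)"
  by (auto simp: smooth_on_interval_def C_on_def)

lemma C_on_0: "C_on 0 I f \<longleftrightarrow> (\<forall>s\<in>I. f differentiable (at s within I))"
  by (simp add: C_on_def)

text \<open>Splits off the innermost derivative, so inductions on \<open>n\<close> must generalise
  over the functions.\<close>

lemma C_on_Suc:
  "C_on (Suc n) I f \<longleftrightarrow>
    (\<forall>s\<in>I. f differentiable (at s within I)) \<and> C_on n I (deriv_on I f)"
proof -
  have "(\<forall>j\<le>Suc n. P j) \<longleftrightarrow> P 0 \<and> (\<forall>j\<le>n. P (Suc j))" for P :: "nat \<Rightarrow> bool"
    by (metis Suc_le_mono le0 not0_implies_Suc)
  then show ?thesis
    unfolding C_on_def by (simp only: funpow_Suc_right funpow_0 o_apply)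
qed

lemma C_on_SucD: "C_on (Suc n) I f \<Longrightarrow> C_on n I f"
  by (simp add: C_on_def)

lemma C_on_differentiable: "C_on n I f \<Longrightarrow> s \<in> I \<Longrightarrow> f differentiable (at s within I)"
  unfolding C_on_def by force

lemma smooth_deriv_on: "smooth_on_interval I f \<Longrightarrow> smooth_on_interval I (deriv_on I f)"
  unfolding smooth_iff_C_on using C_on_Suc[of _ I f] by simp

lemma smooth_differentiable:
  "smooth_on_interval I f \<Longrightarrow> s \<in> I \<Longrightarrow> f differentiable (at s within I)"
  unfolding smooth_iff_C_on by (rule C_on_differentiable[of 0]) simp_all

text \<open>Needed because the sum and product rules determine \<open>deriv_on\<close> only at
  points of \<open>I\<close>.\<close>

lemma C_on_cong:
  assumes "C_on n I f" "\<And>t. t \<in> I \<Longrightarrow> f t = g t"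
  shows "C_on n I g"
  using assms
proof (induction n arbitrary: f g)
  case 0
  then show ?case
    using differentiable_cong_on[of I f g] by (simp add: C_on_0)
next
  case (Suc n)
  have "C_on n I (deriv_on I g)"
  proof (rule Suc.IH)
    show "C_on n I (deriv_on I f)" using Suc.prems(1) by (simp add: C_on_Suc)
    show "deriv_on I f t = deriv_on I g t" if "t \<in> I" for t
      by (rule deriv_on_cong[OF Suc.prems(2) that])
  qed
  then show ?case
    using Suc.prems differentiable_cong_on[of I f g] by (simp add: C_on_Suc)
qed

lemma C_on_add:
  assumes "\<forall>s\<in>I. at s within I \<noteq> bot" "C_on n I f" "C_on n I g"
  shows "C_on n I (\<lambda>s. f s + g s)"
  using assms(2,3)
proof (induction n arbitrary: f g)
  case 0
  then show ?case by (simp add: C_on_0)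
next
  case (Suc n)
  have "C_on n I (deriv_on I (\<lambda>s. f s + g s))"
  proof (rule C_on_cong)
    show "C_on n I (\<lambda>s. deriv_on I f s + deriv_on I g s)"
      using Suc by (simp add: C_on_Suc)
    show "deriv_on I f t + deriv_on I g t = deriv_on I (\<lambda>s. f s + g s) t" if "t \<in> I" for t
      using that assms(1) Suc.prems
      by (intro deriv_on_eqI[symmetric] has_vector_derivative_add
          has_vector_derivative_deriv_on) (auto simp: C_on_Suc)
  qed
  then show ?case using Suc.prems by (simp add: C_on_Suc)
qed

lemma (in bounded_bilinear) differentiable_prod:
  assumes "f differentiable (at s within I)" "g differentiable (at s within I)"
  shows "(\<lambda>s. prod (f s) (g s)) differentiable (at s within I)"
  using assms unfolding differentiable_def by (blast intro: FDERIV)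

text \<open>Induction via the Leibniz rule; the general bilinear form serves both the inner product
  and scalar multiplication.\<close>

lemma (in bounded_bilinear) C_on_prod:
  assumes "\<forall>s\<in>I. at s within I \<noteq> bot" "C_on n I f" "C_on n I g"
  shows "C_on n I (\<lambda>s. prod (f s) (g s))"
  using assms(2,3)
proof (induction n arbitrary: f g)
  case 0
  then show ?case by (simp add: C_on_0 differentiable_prod)
next
  case (Suc n)
  have "C_on n I (deriv_on I (\<lambda>s. prod (f s) (g s)))"
  proof (rule C_on_cong)
    show "C_on n I (\<lambda>s. prod (f s) (deriv_on I g s) + prod (deriv_on I f s) (g s))"
      \<comment> \<open>In each Leibniz term one factor stays undifferentiated;
        \<open>C_on_SucD\<close> lowers its order to \<open>n\<close> for the induction
        hypothesis.\<close>
      using Suc.prems C_on_SucD[OF Suc.prems(1)] C_on_SucD[OF Suc.prems(2)]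
      by (intro C_on_add assms(1) Suc.IH) (auto simp: C_on_Suc)
    show "prod (f t) (deriv_on I g t) + prod (deriv_on I f t) (g t) =
        deriv_on I (\<lambda>s. prod (f s) (g s)) t" if "t \<in> I" for t
      using that assms(1) Suc.prems
      by (intro deriv_on_eqI[symmetric] has_vector_derivative
          has_vector_derivative_deriv_on) (auto simp: C_on_Suc)
  qed
  then show ?case
    using Suc.prems by (simp add: C_on_Suc differentiable_prod)
qed

lemma C_on_const: "\<forall>s\<in>I. at s within I \<noteq> bot \<Longrightarrow> C_on n I (\<lambda>s. c)"
proof (induction n arbitrary: c)
  case 0
  then show ?case by (simp add: C_on_0)
next
  case (Suc n)
  have "deriv_on I (\<lambda>s. c) t = 0" if "t \<in> I" for t
    using Suc.prems that by (intro deriv_on_eqI has_vector_derivative_const) auto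
  then have "C_on n I (deriv_on I (\<lambda>s. c))"
    using Suc by (intro C_on_cong[OF Suc.IH[of 0]]) auto
  then show ?case by (simp add: C_on_Suc)
qed

section \<open>The covariant derivative along the curve\<close>

lemma smooth_cov_deriv:
  assumes I: "\<forall>s\<in>I. at s within I \<noteq> bot"
    and "smooth_on_interval I \<gamma>" "smooth_on_interval I V"
  shows "smooth_on_interval I (cov_deriv I \<gamma> V)"
  unfolding smooth_iff_C_on
proof
  fix n
  have \<gamma>: "C_on n I \<gamma>" and V: "C_on n I (deriv_on I V)"
    using assms(2) smooth_deriv_on[OF assms(3)] by (simp_all add: smooth_iff_C_on)
  note scaleR = bounded_bilinear.C_on_prod[OF bounded_bilinear_scaleR I]
    and inner = bounded_bilinear.C_on_prod[OF bounded_bilinear_inner I]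
  \<comment> \<open>The factor -1 turns the subtraction of the normal part into a sum, as
    \<open>C_on_add\<close> requires.\<close>
  have "C_on n I (\<lambda>s. (-1 :: real) *\<^sub>R ((deriv_on I V s \<bullet> \<gamma> s) *\<^sub>R \<gamma> s))"
    by (rule scaleR[OF C_on_const[OF I] scaleR[OF inner[OF V \<gamma>] \<gamma>]])
  from C_on_add[OF I V this] show "C_on n I (cov_deriv I \<gamma> V)"
    by (simp add: cov_deriv_def)
qed

lemma tangent_field_cov_deriv:
  assumes "\<forall>s\<in>I. at s within I \<noteq> bot"
    and "unit_speed_sphere_curve I \<gamma>" "tangent_field_along I \<gamma> V"
  shows "tangent_field_along I \<gamma> (cov_deriv I \<gamma> V)"
  using assms smooth_cov_deriv[of I \<gamma> V]
  by (auto simp: tangent_field_along_def unit_speed_sphere_curve_def cov_deriv_def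
      inner_diff_left dot_square_norm)

text \<open>Compatibility with the metric: the normal parts removed by the projection are orthogonal
  to the tangent fields \<open>V\<close> and \<open>W\<close>.\<close>

lemma cov_deriv_inner:
  assumes I: "at s within I \<noteq> bot" "s \<in> I"
    and V: "tangent_field_along I \<gamma> V" and W: "tangent_field_along I \<gamma> W"
  shows "deriv_on I (\<lambda>t. V t \<bullet> W t) s =
    V s \<bullet> cov_deriv I \<gamma> W s + cov_deriv I \<gamma> V s \<bullet> W s"
proof -
  have "deriv_on I (\<lambda>t. V t \<bullet> W t) s = V s \<bullet> deriv_on I W s + deriv_on I V s \<bullet> W s"
    using assms
    by (intro deriv_on_eqI bounded_bilinear.has_vector_derivative[OF bounded_bilinear_inner]
        has_vector_derivative_deriv_on smooth_differentiable) (auto simp: tangent_field_along_def)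
  moreover have "V s \<bullet> \<gamma> s = 0" "\<gamma> s \<bullet> W s = 0"
    using V W I by (auto simp: tangent_field_along_def inner_commute)
  ultimately show ?thesis
    by (simp add: cov_deriv_def inner_diff_left inner_diff_right)
qed

section \<open>Components of the iterated derivatives of \<open>T\<close> in the Frenet
  frame\<close>

lemma frenet_cov_deriv_T:
  assumes I: "\<forall>s\<in>I. at s within I \<noteq> bot"
    and \<gamma>: "unit_speed_sphere_curve I \<gamma>"
    and F: "frenet_frame m num n I \<gamma> F k" and n: "n \<ge> 2"
  shows "tangent_field_along I \<gamma> (cov_deriv_T I \<gamma> j) \<and>
    (\<forall>s\<in>I. \<forall>i\<in>{j+1..n}.
      cov_deriv_T I \<gamma> j s \<bullet> F i s = (if i = j + 1 then \<Prod>l=1..j. k l s else 0))"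
proof (induction j)
  case 0
  have F1: "tangent_field_along I \<gamma> (F 1)"
    using F n unfolding frenet_frame_def by simp
  have T: "deriv_on I \<gamma> s = F 1 s" if "s \<in> I" for s
    using F that unfolding frenet_frame_def by simp
  have "\<forall>s\<in>I. \<forall>i\<in>{1..n}. \<forall>j\<in>{1..n}. F i s \<bullet> F j s = (if i = j then 1 else 0)"
    using F unfolding frenet_frame_def by blast
  with n have "F 1 s \<bullet> F i s = (if i = 1 then 1 else 0)" if "s \<in> I" "i \<in> {1..n}" for s i
    using that by auto
  moreover
  have "smooth_on_interval I (deriv_on I \<gamma>)"
    using \<gamma> by (simp add: unit_speed_sphere_curve_def smooth_deriv_on)
  ultimately show ?case
    using T F1 by (simp add: tangent_field_along_def cov_deriv_T_def)
next
  case (Suc j)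
  define V where "V = cov_deriv_T I \<gamma> j"
  \<comment> \<open>Tangency is carried through the induction because \<open>cov_deriv_inner\<close>
    needs it.\<close>
  have V: "tangent_field_along I \<gamma> V"
    and VF: "\<And>s i. s \<in> I \<Longrightarrow> i \<in> {j+1..n} \<Longrightarrow>
      V s \<bullet> F i s = (if i = j + 1 then \<Prod>l=1..j. k l s else 0)"
    using Suc by (auto simp: V_def)
  have "cov_deriv I \<gamma> V s \<bullet> F i s = (if i = j + 2 then \<Prod>l=1..Suc j. k l s else 0)"
    if s: "s \<in> I" and i: "i \<in> {j+2..n}" for s i
  proof -
    \<comment> \<open>As \<open>i > j + 1\<close>, the product vanishes on all of \<open>I\<close>,
      not just at \<open>s\<close>.\<close>
    have "0 = deriv_on I (\<lambda>t. V t \<bullet> F i t) s"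
      using s i I VF
      by (intro deriv_on_eqI[symmetric])
        (auto simp: has_vector_derivative_cong_on[of I "\<lambda>t. V t \<bullet> F i t" "\<lambda>_. 0"])
    also have "\<dots> = V s \<bullet> cov_deriv I \<gamma> (F i) s + cov_deriv I \<gamma> V s \<bullet> F i s"
      using I s V i F by (intro cov_deriv_inner) (auto simp: frenet_frame_def)
    finally have *: "cov_deriv I \<gamma> V s \<bullet> F i s = - (V s \<bullet> cov_deriv I \<gamma> (F i) s)"
      by simp
    \<comment> \<open>Only the backward Frenet term survives: the forward one is absent for
      \<open>i = n\<close> and otherwise pairs \<open>V\<close> with \<open>F (i + 1)\<close>,
      giving 0.\<close>
    have "V s \<bullet> cov_deriv I \<gamma> (F i) s = - k (i - 1) s * (V s \<bullet> F (i - 1) s)"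
    proof (cases "i = n")
      case True
      then show ?thesis using F s by (simp add: frenet_frame_def)
    next
      case False
      then have "i \<in> {2..n - 1}" using i by auto
      then have "cov_deriv I \<gamma> (F i) s = - k (i - 1) s *\<^sub>R F (i - 1) s + k i s *\<^sub>R F (i + 1) s"
        using F s unfolding frenet_frame_def by blast
      moreover have "V s \<bullet> F (i + 1) s = 0"
        using VF[OF s, of "i + 1"] i False by auto
      ultimately show ?thesis by (simp add: inner_diff_right)
    qed
    \<comment> \<open>For \<open>i = j + 2\<close> the product gains the factor
      \<open>k (j + 1)\<close>; for larger \<open>i\<close> the component of \<open>V\<close> along
      \<open>F (i - 1)\<close> is already 0.\<close>
    moreover have "i - 1 \<in> {j+1..n}" "i - 1 = j + 1 \<longleftrightarrow> i = j + 2" using i by auto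
    ultimately show ?thesis using * VF[OF s, of "i - 1"] by (simp add: mult.commute)
  qed
  then show ?case
    using tangent_field_cov_deriv[OF I \<gamma> V] by (simp add: cov_deriv_T_def V_def)
qed

theorem theorem1p9:
  fixes m n r :: nat
    and num :: "'d::finite \<Rightarrow> nat"
    and I :: "real set"
    and \<gamma> :: "real \<Rightarrow> real ^ 'd"
  assumes "CARD('d) = m + 1"
    and "orientation_numbering m num"
    and "m \<ge> n" and "n \<ge> 2" and "r \<ge> 1"
    and "full_frenet_curve m num n I \<gamma>"
    and "n \<ge> 2 * r"
  shows "\<not> r_harmonic r I \<gamma>"
proof
  assume harmonic: "r_harmonic r I \<gamma>"
  obtain F k where \<gamma>: "unit_speed_sphere_curve I \<gamma>"
    and F: "frenet_frame m num n I \<gamma> F k" and full: "\<forall>s\<in>I. k (n - 1) s \<noteq> 0"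
    using assms(6) by (auto simp: full_frenet_curve_def)
  have "is_interval I" "interior I \<noteq> {}"
    using \<gamma> by (auto simp: unit_speed_sphere_curve_def)
  \<comment> \<open>A connected set with more than one point has no isolated points, and a single
    point has empty interior.\<close>
  then have I: "\<forall>s\<in>I. at s within I \<noteq> bot"
    by (metis connected_imp_perfect empty_interior_finite finite.emptyI finite_insert
        is_interval_connected trivial_limit_within)
  \<comment> \<open>Any \<open>s\<close> will do: the tension field turns out to vanish nowhere on
    \<open>I\<close>.\<close>
  obtain s where s: "s \<in> I" using \<open>interior I \<noteq> {}\<close> interior_subset by blast
  note D = frenet_cov_deriv_T[OF I \<gamma> F assms(4), THEN conjunct2, rule_format, OF s]
  have "cov_deriv_T I \<gamma> j s \<bullet> F (2 * r) s = 0" if "j < 2 * r - 1" for j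
    using D[of "2 * r" j] that assms(7) by auto
  \<comment> \<open>The curvature term is a linear combination of its first two arguments, and both
    orders \<open>l\<close> and \<open>2 * r - 3 - l\<close> lie below
    \<open>2 * r - 1\<close>.\<close>
  then have "(sphere_curvature (cov_deriv_T I \<gamma> (2 * r - 3 - l) s) (cov_deriv_T I \<gamma> l s)
      (deriv_on I \<gamma> s)) \<bullet> F (2 * r) s = 0" if "l < r - 1" for l
    using that by (simp add: sphere_curvature_def inner_diff_left)
  then have "tension_field r I \<gamma> s \<bullet> F (2 * r) s = cov_deriv_T I \<gamma> (2 * r - 1) s \<bullet> F (2 * r) s"
    by (simp add: tension_field_def inner_add_left inner_sum_left)
  also have "\<dots> = (\<Prod>l=1..2 * r - 1. k l s)"
    using D[of "2 * r" "2 * r - 1"] assms(5,7) by simp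
  also have "\<dots> \<noteq> 0"
  proof -
    \<comment> \<open>The index \<open>n - 1\<close> occurs only if \<open>n = 2 * r\<close>. For
      \<open>n = m\<close> its curvature may be negative, but fullness keeps it nonzero.\<close>
    have "k l s \<noteq> 0" if "l \<in> {1..2 * r - 1}" for l
    proof (cases "l = n - 1")
      case False
      moreover have "l \<in> {1..n - 1}" using that assms(7) by auto
      ultimately have "k l s > 0" using F s unfolding frenet_frame_def by blast
      then show ?thesis by simp
    qed (use full s in simp)
    then show ?thesis by simp
  qed
  finally show False using harmonic s by (simp add: r_harmonic_def)
qed

end
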